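(* Let $A, B, X \in \mathbb{M}_n$ be such that $A$ and $B$ are positive semidefinite, and let $\nu \in (0,1)$. Then $$\|A^{1-\nu}XB^{\nu}\|_2^2 + r_0^2\|AX-XB\|_2^2 + \sum_{k=1}^{\infty} r_k\Big\|A^{1-\frac{m_k}{2^k}}XB^{\frac{m_k}{2^k}} - A^{1-\frac{m_k+1}{2^k}}XB^{\frac{m_k+1}{2^k}}\Big\|_2^2 \leq \|(1-\nu)AX+\nu XB\|_2^2 .$$
   Context: $\mathbb{M}_n$ is the algebra of $n\times n$ complex matrices and $\|A\|_2=\big(\sum_{i,j}|a_{ij}|^2\big)^{1/2}$ is the Hilbert-Schmidt norm of $A=(a_{ij})$. For $0<\nu<1$ and integers $k\ge 0$, $m_k=\lfloor 2^k\nu\rfloor$ is the largest integer not greater than $2^k\nu$; $r_0=\min\{\nu,1-\nu\}$ and $r_k=\min\{2r_{k-1},\,1-2r_{k-1}\}$ for $k\ge 1$. Powers of positive semidefinite matrices are defined by functional calculus, with the zeroth power equal to the identity matrix. *)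

theory Defs
  imports "HOL-Analysis.Analysis"
begin

definition conj_transpose :: "complex^'n^'m \<Rightarrow> complex^'m^'n" where
  "conj_transpose A = (\<chi> i j. cnj (A $ j $ i))"

definition hermitian :: "complex^'n^'n \<Rightarrow> bool" where
  "hermitian A \<longleftrightarrow> conj_transpose A = A"

definition unitary :: "complex^'n^'n \<Rightarrow> bool" where
  "unitary U \<longleftrightarrow> conj_transpose U ** U = mat 1 \<and> U ** conj_transpose U = mat 1"

definition pos_semidef :: "complex^'n^'n \<Rightarrow> bool" where
  "pos_semidef A \<longleftrightarrow> hermitian A \<and>
     (\<forall>x :: complex^'n. (\<Sum>i\<in>UNIV. cnj (x $ i) * (A *v x) $ i) \<in> \<real>\<^sub>\<ge>\<^sub>0)"

definition hs_norm :: "complex^'n^'m \<Rightarrow> real" where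
  "hs_norm A = sqrt (\<Sum>i\<in>UNIV. \<Sum>j\<in>UNIV. (cmod (A $ i $ j))\<^sup>2)"

definition real_diag :: "('n \<Rightarrow> real) \<Rightarrow> complex^'n^'n" where
  "real_diag d = (\<chi> i j. if i = j then complex_of_real (d i) else 0)"

(* Functional calculus of a Hermitian matrix.  A diagonalisation exists by the spectral theorem;
   by the lemma matrix_fun_eq below the result does not depend on the diagonalisation chosen. *)
definition matrix_fun :: "(real \<Rightarrow> real) \<Rightarrow> complex^'n^'n \<Rightarrow> complex^'n^'n" where
  "matrix_fun f A = (THE B. \<exists>U d. unitary U \<and>
     A = U ** real_diag d ** conj_transpose U \<and>
     B = U ** real_diag (\<lambda>i. f (d i)) ** conj_transpose U)"

(* 0 powr 0 = 0 in HOL, hence the case distinction: the zeroth power is the identity matrix. *)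
definition matrix_powr :: "complex^'n^'n \<Rightarrow> real \<Rightarrow> complex^'n^'n" where
  "matrix_powr A t = matrix_fun (\<lambda>x. if t = 0 then 1 else x powr t) A"

definition young_m :: "real \<Rightarrow> nat \<Rightarrow> int" where
  "young_m \<nu> k = \<lfloor>2 ^ k * \<nu>\<rfloor>"

primrec young_r :: "real \<Rightarrow> nat \<Rightarrow> real" where
  "young_r \<nu> 0 = min \<nu> (1 - \<nu>)"
| "young_r \<nu> (Suc k) = min (2 * young_r \<nu> k) (1 - 2 * young_r \<nu> k)"

lemma matrix_fun_eq:
  fixes U :: "complex^'n^'n"
  assumes U: "unitary U" and A: "A = U ** real_diag d ** conj_transpose U"
  shows "matrix_fun f A = U ** real_diag (\<lambda>i. f (d i)) ** conj_transpose U"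
proof -
  have diag_left: "(real_diag g ** M) $ i $ j = complex_of_real (g i) * M $ i $ j"
    for g and M :: "complex^'n^'n" and i j
    by (simp add: real_diag_def matrix_matrix_mult_def if_distrib[of "\<lambda>x. x * _"] cong: if_cong)
  have diag_right: "(M ** real_diag g) $ i $ j = M $ i $ j * complex_of_real (g j)"
    for g and M :: "complex^'n^'n" and i j
    by (simp add: real_diag_def matrix_matrix_mult_def if_distrib[of "\<lambda>x. _ * x"] cong: if_cong)
  have "V ** real_diag (\<lambda>i. f (e i)) ** conj_transpose V
      = U ** real_diag (\<lambda>i. f (d i)) ** conj_transpose U"
    if V: "unitary V" and AV: "A = V ** real_diag e ** conj_transpose V" for V e
  proof -
    define W where "W = conj_transpose V ** U"
    have "conj_transpose V ** A ** U = W ** real_diag d"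
      unfolding A W_def using U unfolding unitary_def
      by (simp flip: matrix_mul_assoc)
    moreover have "conj_transpose V ** A ** U = real_diag e ** W"
      unfolding AV W_def using V unfolding unitary_def
      by (simp add: matrix_mul_assoc)
    ultimately have "W $ i $ j * complex_of_real (d j) = complex_of_real (e i) * W $ i $ j" for i j
      by (metis diag_left diag_right)
    then have "W $ i $ j = 0 \<or> d j = e i" for i j
      by (metis mult.commute mult_cancel_left of_real_eq_iff)
    then have "W $ i $ j * complex_of_real (f (d j)) = complex_of_real (f (e i)) * W $ i $ j" for i j
      by (metis mult.commute mult_zero_right)
    then have "W ** real_diag (\<lambda>i. f (d i)) = real_diag (\<lambda>i. f (e i)) ** W"
      by (simp add: vec_eq_iff diag_left diag_right)
    then have "V ** (W ** real_diag (\<lambda>i. f (d i))) ** conj_transpose U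
             = V ** (real_diag (\<lambda>i. f (e i)) ** W) ** conj_transpose U"
      by simp
    moreover have "V ** (W ** real_diag (\<lambda>i. f (d i))) = U ** real_diag (\<lambda>i. f (d i))"
      unfolding W_def using V unfolding unitary_def by (simp add: matrix_mul_assoc)
    moreover have "W ** conj_transpose U = conj_transpose V"
      unfolding W_def using U unfolding unitary_def by (simp flip: matrix_mul_assoc)
    ultimately show ?thesis
      by (simp flip: matrix_mul_assoc)
  qed
  then show ?thesis
    unfolding matrix_fun_def using U A by (intro the_equality) blast+
qed

end

theory Submission
  imports Defs
begin

text \<open>
  Diagonalising \<open>A\<close> and \<open>B\<close> makes every matrix in the inequality a Schur multiple of one
  matrix \<open>Y\<close> in the eigenbases, so the claim follows by summing, with weights \<open>|Y\<^sub>i\<^sub>j|\<^sup>2\<close>,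
  scalar inequalities for pairs of eigenvalues \<open>a, b\<close>.

  For scalars put \<open>g x = a\<^bsup>1-x\<^esup> b\<^bsup>x\<^esup>\<close>, and let \<open>L\<^sub>k\<close> be the value at \<open>\<nu>\<close> of the linear
  interpolation of \<open>g\<^sup>2\<close> between the two dyadic neighbours of \<open>\<nu>\<close> of level \<open>k\<close>. Since \<open>g\<^sup>2\<close>
  at a midpoint is the product of the values of \<open>g\<close> at the two ends, and \<open>r\<^sub>k\<close> is the distance of
  \<open>2\<^sup>k \<nu>\<close> to the nearest integer, \<open>L\<^sub>k - L\<^sub>k\<^sub>+\<^sub>1\<close> is exactly the \<open>k\<close>-th term of the series.
  Telescoping and \<open>(g \<nu>)\<^sup>2 \<le> L\<^sub>n\<close> (convexity) give a refined Young inequality for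
  \<open>(1 - \<nu>) a\<^sup>2 + \<nu> b\<^sup>2\<close>, which differs from \<open>((1 - \<nu>) a + \<nu> b)\<^sup>2\<close> by
  \<open>\<nu> (1 - \<nu>) (a - b)\<^sup>2 = (r\<^sub>0 - r\<^sub>0\<^sup>2) (a - b)\<^sup>2\<close>.
\<close>

section \<open>The scalar inequality\<close>

text \<open>Same convention as the function inside \<open>matrix_powr\<close>, so that functional
  calculus yields \<open>geo_mean\<close> of the eigenvalues verbatim.\<close>

definition real_pow :: "real \<Rightarrow> real \<Rightarrow> real" where
  "real_pow t x = (if t = 0 then 1 else x powr t)"

definition geo_mean :: "real \<Rightarrow> real \<Rightarrow> real \<Rightarrow> real" where
  "geo_mean a b x = real_pow (1 - x) a * real_pow x b"

lemma real_pow_pos: "a > 0 \<Longrightarrow> real_pow t a = exp (t * ln a)"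
  by (simp add: real_pow_def powr_def)

lemma geo_mean_pos:
  assumes "a > 0" "b > 0"
  shows "geo_mean a b x = exp ((1 - x) * ln a + x * ln b)"
  using assms by (simp add: geo_mean_def real_pow_pos exp_add)

lemma geo_mean_endpoints:
  assumes "a \<ge> 0" "b \<ge> 0"
  shows "geo_mean a b 0 = a" "geo_mean a b 1 = b"
  using assms by (simp_all add: geo_mean_def real_pow_def)

lemma geo_mean_degenerate:
  assumes "a = 0 \<or> b = 0" "0 < x" "x < 1"
  shows "geo_mean a b x = 0"
  using assms by (auto simp: geo_mean_def real_pow_def)

text \<open>For positive \<open>a\<close>, \<open>b\<close> the logarithm of \<open>geo_mean\<close>
  is affine in the exponent. Otherwise both sides vanish: the midpoint lies strictly between 0 and
  1, while \<open>p < 1\<close> kills the factor at \<open>p\<close> if \<open>a = 0\<close>, and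
  \<open>q > 0\<close> the one at \<open>q\<close> if \<open>b = 0\<close>.\<close>

lemma geo_mean_midpoint:
  assumes "a \<ge> 0" "b \<ge> 0" "0 \<le> p" "p < q" "q \<le> 1"
  shows "(geo_mean a b ((p + q) / 2))\<^sup>2 = geo_mean a b p * geo_mean a b q"
proof (cases "a > 0 \<and> b > 0")
  case True
  then show ?thesis
    by (simp add: geo_mean_pos power2_eq_square flip: exp_add) (simp add: field_simps)
next
  case False
  then have "a = 0 \<or> b = 0" using assms by auto
  moreover have "geo_mean a b ((p + q) / 2) = 0"
    using calculation assms by (intro geo_mean_degenerate) auto
  moreover have "geo_mean a b p = 0 \<or> geo_mean a b q = 0"
    using calculation(1) assms by (auto simp: geo_mean_def real_pow_def)
  ultimately show ?thesis by auto
qed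

text \<open>The square is the exponential of an affine function when \<open>a\<close> and
  \<open>b\<close> are positive; otherwise the left side is zero because \<open>x\<close> is
  interior.\<close>

lemma geo_mean_square_convex:
  assumes "a \<ge> 0" "b \<ge> 0" "0 \<le> t" "t \<le> 1" "0 < x" "x < 1" "x = (1 - t) * p + t * q"
  shows "(geo_mean a b x)\<^sup>2 \<le> (1 - t) * (geo_mean a b p)\<^sup>2 + t * (geo_mean a b q)\<^sup>2"
proof (cases "a > 0 \<and> b > 0")
  case True
  have sq: "(geo_mean a b y)\<^sup>2 = exp (2 * ((1 - y) * ln a + y * ln b))" for y
    using True by (simp add: geo_mean_pos flip: exp_double)
  have "2 * ((1 - x) * ln a + x * ln b)
      = (1 - t) * (2 * ((1 - p) * ln a + p * ln b)) + t * (2 * ((1 - q) * ln a + q * ln b))"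
    unfolding assms(7) by (simp add: algebra_simps)
  then show ?thesis
    unfolding sq
    using convex_onD[OF exp_convex, of t "2 * ((1 - p) * ln a + p * ln b)" "2 * ((1 - q) * ln a + q * ln b)"]
      assms(3,4) by (simp only: real_scaleR_def UNIV_I)
next
  case False
  then have "geo_mean a b x = 0" using assms by (intro geo_mean_degenerate) auto
  then show ?thesis using assms by simp
qed

text \<open>Doubling reveals one binary digit of the fractional part, which is 0 exactly when
  \<open>frac x < 1/2\<close>.\<close>

lemma floor_frac_double:
  fixes x :: real
  shows "\<lfloor>2 * x\<rfloor> = (if frac x < 1/2 then 2 * \<lfloor>x\<rfloor> else 2 * \<lfloor>x\<rfloor> + 1)"
    and "frac (2 * x) = (if frac x < 1/2 then 2 * frac x else 2 * frac x - 1)"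
proof -
  show "\<lfloor>2 * x\<rfloor> = (if frac x < 1/2 then 2 * \<lfloor>x\<rfloor> else 2 * \<lfloor>x\<rfloor> + 1)"
    unfolding frac_def by (auto intro!: floor_unique) linarith+
  then show "frac (2 * x) = (if frac x < 1/2 then 2 * frac x else 2 * frac x - 1)"
    unfolding frac_def by (auto split: if_splits)
qed

text \<open>If \<open>x\<close> has distance \<open>d\<close> to the nearest integer, then
  \<open>2 * x\<close> has distance \<open>min (2 * d) (1 - 2 * d)\<close>, which is the recursion
  of \<open>young_r\<close>.\<close>

lemma young_r_eq_dist_int:
  assumes "0 < \<nu>" "\<nu> < 1"
  shows "young_r \<nu> k = min (frac (2 ^ k * \<nu>)) (1 - frac (2 ^ k * \<nu>))"
proof (induction k)
  case 0
  have "frac \<nu> = \<nu>" using assms by (simp add: frac_eq)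
  then show ?case by simp
next
  case (Suc k)
  then show ?case
    using floor_frac_double(2)[of "2 ^ k * \<nu>"] frac_lt_1[of "2 ^ k * \<nu>"]
      frac_ge_0[of "2 ^ k * \<nu>"]
    by (auto simp: mult.assoc min_def)
qed

lemma young_r_nonneg: "0 < \<nu> \<Longrightarrow> \<nu> < 1 \<Longrightarrow> 0 \<le> young_r \<nu> k"
  by (simp add: young_r_eq_dist_int frac_lt_1 less_imp_le)

text \<open>This is \<open>L\<^sub>k\<close> of the overview; the weight
  \<open>frac (2 ^ k * \<nu>)\<close> is the relative position of \<nu> in its dyadic interval of
  level \<open>k\<close>.\<close>

definition dyadic_interp :: "real \<Rightarrow> real \<Rightarrow> real \<Rightarrow> nat \<Rightarrow> real" where
  "dyadic_interp a b \<nu> k =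
     (1 - frac (2 ^ k * \<nu>)) * (geo_mean a b (young_m \<nu> k / 2 ^ k))\<^sup>2
     + frac (2 ^ k * \<nu>) * (geo_mean a b ((young_m \<nu> k + 1) / 2 ^ k))\<^sup>2"

lemma dyadic_range:
  assumes "0 < \<nu>" "\<nu> < 1"
  shows "0 \<le> young_m \<nu> k / 2 ^ k" "(young_m \<nu> k + 1) / 2 ^ k \<le> 1"
proof -
  show "0 \<le> young_m \<nu> k / 2 ^ k" using assms by (simp add: young_m_def)
  have "2 ^ k * \<nu> < real_of_int (2 ^ k)" using assms by simp
  then have "young_m \<nu> k < 2 ^ k" unfolding young_m_def by (simp only: floor_less_iff)
  then have "real_of_int (young_m \<nu> k + 1) \<le> real_of_int (2 ^ k)"
    by (simp only: of_int_le_iff)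
  then show "(young_m \<nu> k + 1) / 2 ^ k \<le> 1" by simp
qed

text \<open>Refinement replaces one end of the interval by its midpoint: the right end if
  \<open>t < 1/2\<close>, else the left. Since the squared mean there is the product of the end
  values, the loss is \<open>t\<close> or \<open>1 - t\<close> times a perfect square.\<close>

lemma dyadic_interp_Suc:
  assumes "a \<ge> 0" "b \<ge> 0" "0 < \<nu>" "\<nu> < 1"
  shows "dyadic_interp a b \<nu> k = dyadic_interp a b \<nu> (Suc k) + young_r \<nu> k *
     (geo_mean a b (young_m \<nu> k / 2 ^ k) - geo_mean a b ((young_m \<nu> k + 1) / 2 ^ k))\<^sup>2"
proof -
  define p where "p = young_m \<nu> k / 2 ^ k"
  define q where "q = (young_m \<nu> k + 1) / 2 ^ k"
  define m where "m = young_m \<nu> k"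
  define t where "t = frac (2 ^ k * \<nu>)"
  have mid: "(geo_mean a b ((p + q) / 2))\<^sup>2 = geo_mean a b p * geo_mean a b q"
    using assms dyadic_range[of \<nu> k]
    by (intro geo_mean_midpoint) (auto simp: p_def q_def divide_strict_right_mono)
  have r: "young_r \<nu> k = (if t < 1/2 then t else 1 - t)"
    using assms by (simp add: young_r_eq_dist_int t_def)
  have k: "dyadic_interp a b \<nu> k = (1 - t) * (geo_mean a b p)\<^sup>2 + t * (geo_mean a b q)\<^sup>2"
    by (simp add: dyadic_interp_def p_def q_def t_def)
  have m': "young_m \<nu> (Suc k) = (if t < 1/2 then 2 * m else 2 * m + 1)"
    and t': "frac (2 ^ Suc k * \<nu>) = (if t < 1/2 then 2 * t else 2 * t - 1)"
    using floor_frac_double[of "2 ^ k * \<nu>"] by (simp_all add: young_m_def m_def t_def mult.assoc)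
  have l: "young_m \<nu> (Suc k) / 2 ^ Suc k = (if t < 1/2 then p else (p + q) / 2)"
    and u: "(young_m \<nu> (Suc k) + 1) / 2 ^ Suc k = (if t < 1/2 then (p + q) / 2 else q)"
    unfolding m' by (simp_all add: p_def q_def m_def field_simps)
  show ?thesis
  proof (cases "t < 1/2")
    case True
    then have "dyadic_interp a b \<nu> (Suc k)
        = (1 - 2 * t) * (geo_mean a b p)\<^sup>2 + 2 * t * (geo_mean a b p * geo_mean a b q)"
      unfolding dyadic_interp_def l u t' by (simp add: mid)
    then show ?thesis
      unfolding k r p_def[symmetric] q_def[symmetric] using True
      by (simp add: power2_diff) (simp add: algebra_simps)
  next
    case False
    then have "dyadic_interp a b \<nu> (Suc k)
        = (2 - 2 * t) * (geo_mean a b p * geo_mean a b q) + (2 * t - 1) * (geo_mean a b q)\<^sup>2"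
      unfolding dyadic_interp_def l u t' by (simp add: mid)
    then show ?thesis
      unfolding k r p_def[symmetric] q_def[symmetric] using False
      by (simp add: power2_diff) (simp add: algebra_simps)
  qed
qed

lemma geo_mean_le_dyadic_interp:
  assumes "a \<ge> 0" "b \<ge> 0" "0 < \<nu>" "\<nu> < 1"
  shows "(geo_mean a b \<nu>)\<^sup>2 \<le> dyadic_interp a b \<nu> k"
  unfolding dyadic_interp_def
proof (rule geo_mean_square_convex)
  show "\<nu> = (1 - frac (2 ^ k * \<nu>)) * (young_m \<nu> k / 2 ^ k)
      + frac (2 ^ k * \<nu>) * ((young_m \<nu> k + 1) / 2 ^ k)"
    by (simp add: frac_def young_m_def field_simps)
qed (use assms in \<open>auto simp: frac_lt_1 less_imp_le\<close>)

lemma refined_young_scalar: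
  assumes "a \<ge> 0" "b \<ge> 0" "0 < \<nu>" "\<nu> < 1"
  shows "(geo_mean a b \<nu>)\<^sup>2 + (young_r \<nu> 0)\<^sup>2 * (a - b)\<^sup>2
    + (\<Sum>k=1..n. young_r \<nu> k *
        (geo_mean a b (young_m \<nu> k / 2 ^ k) - geo_mean a b ((young_m \<nu> k + 1) / 2 ^ k))\<^sup>2)
    \<le> ((1 - \<nu>) * a + \<nu> * b)\<^sup>2"
proof -
  have m0: "young_m \<nu> 0 = 0" and f0: "frac \<nu> = \<nu>"
    using assms by (simp_all add: young_m_def frac_eq floor_eq_iff)
  \<comment> \<open>Telescoping starts at level 1; the level 0 term has the coefficient
    \<open>young_r \<nu> 0\<close>, which is lowered to its square below.\<close>
  have "dyadic_interp a b \<nu> 1 = dyadic_interp a b \<nu> (Suc n) + (\<Sum>k=1..n. young_r \<nu> k *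
        (geo_mean a b (young_m \<nu> k / 2 ^ k) - geo_mean a b ((young_m \<nu> k + 1) / 2 ^ k))\<^sup>2)"
  proof (induction n)
    case (Suc n)
    then show ?case
      using dyadic_interp_Suc[OF assms, of "Suc n"] by (simp del: young_r.simps)
  qed simp
  moreover have "(1 - \<nu>) * a\<^sup>2 + \<nu> * b\<^sup>2 = dyadic_interp a b \<nu> 1 + young_r \<nu> 0 * (a - b)\<^sup>2"
    using dyadic_interp_Suc[OF assms, of 0] assms
    by (simp add: dyadic_interp_def[of _ _ _ 0] m0 f0 geo_mean_endpoints del: young_r.simps)
  moreover have "((1 - \<nu>) * a + \<nu> * b)\<^sup>2
      = (1 - \<nu>) * a\<^sup>2 + \<nu> * b\<^sup>2 - \<nu> * (1 - \<nu>) * (a - b)\<^sup>2"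
    by (simp add: power2_eq_square algebra_simps)
  moreover have "\<nu> * (1 - \<nu>) = young_r \<nu> 0 - (young_r \<nu> 0)\<^sup>2"
    by (simp add: min_def power2_eq_square algebra_simps)
  ultimately show ?thesis
    using geo_mean_le_dyadic_interp[OF assms, of "Suc n"]
    by (simp only: left_diff_distrib)
qed

section \<open>The spectral theorem\<close>

definition cinner :: "complex^'n \<Rightarrow> complex^'n \<Rightarrow> complex" where
  "cinner x y = (\<Sum>i\<in>UNIV. cnj (x $ i) * y $ i)"

lemma inner_eq_Re_cinner: "x \<bullet> y = Re (cinner x y)"
  by (simp add: inner_vec_def cinner_def inner_complex_def)

lemma cinner_self: "cinner x x = complex_of_real (x \<bullet> x)"
  unfolding inner_vec_def cinner_def of_real_sum
  by (intro sum.cong refl) (simp add: complex_eq_iff inner_complex_def)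

lemma cnj_cinner: "cnj (cinner x y) = cinner y x"
  by (simp add: cinner_def mult.commute)

lemma cinner_add_right: "cinner x (y + z) = cinner x y + cinner x z"
  by (simp add: cinner_def algebra_simps sum.distrib)

lemma cinner_scaleR_right: "cinner x (c *\<^sub>R y) = c *\<^sub>R cinner x y"
  by (simp add: cinner_def scaleR_sum_right)

lemma cinner_scaleR_left: "cinner (c *\<^sub>R x) y = c *\<^sub>R cinner x y"
  by (simp add: cinner_def scaleR_sum_right)

lemma continuous_on_cinner: "continuous_on S (cinner x)"
  unfolding cinner_def by (intro continuous_intros)

lemma cinner_matrix: "cinner x (A *v y) = cinner (conj_transpose A *v x) y"
proof -
  have "cinner x (A *v y) = (\<Sum>i\<in>UNIV. \<Sum>j\<in>UNIV. cnj (x $ i) * (A $ i $ j * y $ j))"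
    by (simp add: cinner_def matrix_vector_mult_def sum_distrib_left)
  also have "\<dots> = (\<Sum>j\<in>UNIV. \<Sum>i\<in>UNIV. cnj (x $ i) * (A $ i $ j * y $ j))"
    by (rule sum.swap)
  also have "\<dots> = cinner (conj_transpose A *v x) y"
    by (simp add: cinner_def matrix_vector_mult_def conj_transpose_def sum_distrib_left sum_distrib_right mult_ac)
  finally show ?thesis .
qed

lemma matrix_vector_mult_scaleR_complex:
  fixes A :: "complex^'n^'m"
  shows "A *v (c *\<^sub>R x) = c *\<^sub>R (A *v x)"
  by (simp add: vec_eq_iff matrix_vector_mult_def scaleR_sum_right)

text \<open>The quadratic form of \<open>A\<close> attains a maximum on the compact unit sphere of
  \<open>W\<close>, and a maximiser is an eigenvector. The real inner product suffices and makes the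
  eigenvalue real.\<close>

lemma rayleigh_eigenvector:
  fixes A :: "complex^'n^'n"
  assumes herm: "hermitian A" and W: "subspace W" "closed W"
    and inv: "\<And>x. x \<in> W \<Longrightarrow> A *v x \<in> W" and ne: "\<exists>x\<in>W. x \<noteq> 0"
  shows "\<exists>v\<in>W. \<exists>c::real. v \<bullet> v = 1 \<and> A *v v = c *\<^sub>R v"
proof -
  have sym: "x \<bullet> (A *v y) = (A *v x) \<bullet> y" for x y
    using herm cinner_matrix[of x A y] by (simp add: inner_eq_Re_cinner hermitian_def)
  define S where "S = W \<inter> sphere 0 1"
  have cS: "compact S" unfolding S_def using W by (simp add: closed_Int_compact)
  obtain x where x: "x \<in> W" "x \<noteq> 0" using ne by blast
  then have "(1 / norm x) *\<^sub>R x \<in> S"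
    using W by (simp add: S_def subspace_scale)
  then have Sne: "S \<noteq> {}" by blast
  have "continuous_on S (\<lambda>x. x \<bullet> (A *v x))"
    by (intro continuous_intros)
  from continuous_attains_sup[OF cS Sne this] obtain v
    where v: "v \<in> S" and max: "\<And>y. y \<in> S \<Longrightarrow> y \<bullet> (A *v y) \<le> v \<bullet> (A *v v)" by blast
  have vW: "v \<in> W" and vv: "v \<bullet> v = 1" using v by (auto simp: S_def norm_eq_1)
  define c where "c = v \<bullet> (A *v v)"
  have quad: "y \<bullet> (A *v y) \<le> c * (y \<bullet> y)" if "y \<in> W" for y
  proof (cases "y = 0")
    case False
    define u where "u = (1 / norm y) *\<^sub>R y"
    have "u \<in> S" using that False W by (simp add: S_def u_def subspace_scale)
    from max[OF this] have "u \<bullet> (A *v u) \<le> c" by (simp add: c_def)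
    moreover have "u \<bullet> (A *v u) = (y \<bullet> (A *v y)) / (y \<bullet> y)"
      by (simp add: u_def matrix_vector_mult_scaleR_complex dot_square_norm power2_eq_square)
    ultimately show ?thesis using False by (simp add: field_simps)
  qed simp
  \<comment> \<open>The form \<open>c * (y \<bullet> y) - y \<bullet> (A *v y)\<close> is nonnegative on \<open>W\<close> and vanishes at \<open>v\<close>;
    testing it along \<open>v + t *\<^sub>R z\<close> forces the residual \<open>z\<close> to vanish.\<close>
  define z where "z = c *\<^sub>R v - A *v v"
  define s where "s = z \<bullet> z"
  define \<phi> where "\<phi> = c * s - z \<bullet> (A *v z)"
  have zW: "z \<in> W" unfolding z_def using W vW inv by (simp add: subspace_diff subspace_scale)
  have pos: "0 \<le> \<phi>" using quad[OF zW] by (simp add: \<phi>_def s_def)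
  have cross: "c * (v \<bullet> z) - z \<bullet> (A *v v) = s"
    unfolding s_def by (subst (3) z_def) (simp add: inner_diff_right inner_commute)
  have nonneg: "0 \<le> 2 * t * s + t\<^sup>2 * \<phi>" for t
  proof -
    have "v + t *\<^sub>R z \<in> W" using W vW zW by (simp add: subspace_add subspace_scale)
    from quad[OF this] have "0 \<le> c * ((v + t *\<^sub>R z) \<bullet> (v + t *\<^sub>R z)) - (v + t *\<^sub>R z) \<bullet> (A *v (v + t *\<^sub>R z))"
      by simp
    also have "\<dots> = (c * (v \<bullet> v) - v \<bullet> (A *v v)) + 2 * t * (c * (v \<bullet> z) - z \<bullet> (A *v v)) + t\<^sup>2 * \<phi>"
      using sym[of v z] unfolding \<phi>_def s_def
      by (simp add: matrix_vector_right_distrib matrix_vector_mult_scaleR_complex inner_add_left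
          inner_add_right inner_commute power2_eq_square algebra_simps)
    also have "\<dots> = 2 * t * s + t\<^sup>2 * \<phi>" unfolding cross by (simp add: c_def vv)
    finally show ?thesis .
  qed
  have "s = 0"
  proof (rule ccontr)
    assume "s \<noteq> 0"
    then have "s > 0" by (simp add: s_def)
    \<comment> \<open>The step \<open>- r\<close> is small enough for the linear term to dominate:
      the form becomes \<open>- (r\<^sup>2 * (\<phi> + 2))\<close>.\<close>
    define r where "r = s / (\<phi> + 1)"
    have "s = r * (\<phi> + 1)" and "r > 0" using pos \<open>s > 0\<close> by (simp_all add: r_def)
    then have "2 * (- r) * s + (- r)\<^sup>2 * \<phi> = - (r\<^sup>2 * (\<phi> + 2))"
      by (simp add: power2_eq_square algebra_simps)
    moreover have "r\<^sup>2 * (\<phi> + 2) > 0" using \<open>r > 0\<close> pos by simp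
    ultimately show False using nonneg[of "- r"] by simp
  qed
  then have "A *v v = c *\<^sub>R v" by (simp add: s_def z_def)
  then show ?thesis using vW vv by blast
qed

text \<open>Induction on \<open>I\<close>: the orthogonal complement \<open>W\<close> of the
  eigenvectors found so far is invariant under \<open>A\<close> and supplies the next one. Indexing
  by matrix indices makes \<open>I = UNIV\<close> a full basis.\<close>

lemma hermitian_orthonormal_eigenvectors:
  fixes A :: "complex^'n^'n" and I :: "'n set"
  assumes herm: "hermitian A"
  shows "\<exists>u d. \<forall>i\<in>I. A *v u i = d i *\<^sub>R u i \<and>
           (\<forall>j\<in>I. cinner (u i) (u j) = (if i = j then 1 else 0))"
proof (induction I rule: finite_induct[OF finite])
  case (2 k I)
  then obtain u d where u: "\<And>i. i \<in> I \<Longrightarrow> A *v u i = d i *\<^sub>R u i"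
    and on: "\<And>i j. i \<in> I \<Longrightarrow> j \<in> I \<Longrightarrow> cinner (u i) (u j) = (if i = j then 1 else 0)" by blast
  define W where "W = {x. \<forall>i\<in>I. cinner (u i) x = 0}"
  have sub: "subspace W"
    unfolding subspace_def W_def
    by (simp add: cinner_add_right cinner_scaleR_right) (simp add: cinner_def)
  have "W = (\<Inter>i\<in>I. {x. cinner (u i) x = 0})" by (auto simp: W_def)
  moreover have "closed {x. cinner (u i) x = 0}" for i
    by (intro closed_Collect_eq continuous_on_cinner continuous_on_const)
  ultimately have clo: "closed W" by auto
  have inv: "A *v x \<in> W" if "x \<in> W" for x
    using that herm by (auto simp: W_def cinner_matrix hermitian_def u cinner_scaleR_left)
  \<comment> \<open>Row \<open>k\<close> of \<open>M\<close> is zero, so \<open>M\<close> is singular and its kernel meets \<open>W\<close> nontrivially.\<close>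
  define M :: "complex^'n^'n" where "M = (\<chi> i j. if i \<in> I then cnj (u i $ j) else 0)"
  have "row k M = 0" using \<open>k \<notin> I\<close> by (simp add: row_def M_def vec_eq_iff)
  then have "det M = 0" by (rule det_zero_row)
  then have "\<not> invertible M" by (simp add: invertible_det_nz)
  then obtain x where "M *v x = 0" "x \<noteq> 0"
    using matrix_left_invertible_ker[of M] by (auto simp: invertible_left_inverse)
  have "cinner (u i) x = (M *v x) $ i" if "i \<in> I" for i
    using that by (simp add: cinner_def matrix_vector_mult_def M_def)
  then have "x \<in> W" using \<open>M *v x = 0\<close> by (simp add: W_def)
  with \<open>x \<noteq> 0\<close> have "\<exists>x\<in>W. x \<noteq> 0" by blast
  from rayleigh_eigenvector[OF herm sub clo inv this]
  obtain v c where v: "v \<in> W" "v \<bullet> v = 1" "A *v v = c *\<^sub>R v" by blast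
  have "cinner (u i) v = 0" "cinner v (u i) = 0" if "i \<in> I" for i
    using v(1) that cnj_cinner[of "u i" v] by (auto simp: W_def)
  moreover have "cinner v v = 1" using v(2) by (simp add: cinner_self)
  ultimately show ?case
    using u on v(3) \<open>k \<notin> I\<close>
    by (intro exI[of _ "u(k := v)"] exI[of _ "d(k := c)"]) auto
qed auto

text \<open>The last clause exhibits each eigenvalue as a value of the quadratic form, so positivity
  of the form passes to the eigenvalues.\<close>

theorem hermitian_spectral:
  fixes A :: "complex^'n^'n"
  assumes "hermitian A"
  obtains U d where "unitary U" "A = U ** real_diag d ** conj_transpose U"
    "\<And>i. \<exists>x. cinner x (A *v x) = complex_of_real (d i)"
proof -
  obtain u :: "'n \<Rightarrow> complex^'n" and d where u: "\<And>i. A *v u i = d i *\<^sub>R u i"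
    and on: "\<And>i j. cinner (u i) (u j) = (if i = j then 1 else 0)"
    using hermitian_orthonormal_eigenvectors[OF assms, of UNIV] by blast
  define U :: "complex^'n^'n" where "U = (\<chi> i j. u j $ i)"
  have UU: "conj_transpose U ** U = mat 1"
    using on by (simp add: vec_eq_iff matrix_matrix_mult_def conj_transpose_def U_def mat_def cinner_def)
  then have UU': "U ** conj_transpose U = mat 1" by (simp add: matrix_left_right_inverse)
  have "(A ** U) $ i $ j = (U ** real_diag d) $ i $ j" for i j
  proof -
    have "(A ** U) $ i $ j = (A *v u j) $ i"
      by (simp add: matrix_matrix_mult_def matrix_vector_mult_def U_def)
    also have "\<dots> = (U ** real_diag d) $ i $ j"
      by (simp add: u matrix_matrix_mult_def real_diag_def U_def if_distrib[of "\<lambda>x. _ * x"]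
          scaleR_conv_of_real[where 'a = complex] mult.commute cong: if_cong)
    finally show ?thesis .
  qed
  then have "A ** U = U ** real_diag d" by (simp add: vec_eq_iff)
  then have "A = U ** real_diag d ** conj_transpose U"
    by (metis UU' matrix_mul_assoc matrix_mul_rid)
  moreover have "cinner (u i) (A *v u i) = complex_of_real (d i)" for i
    by (simp add: u cinner_scaleR_right on scaleR_conv_of_real[where 'a = complex])
  ultimately show ?thesis using UU UU' that unfolding unitary_def by blast
qed

lemma pos_semidef_spectral:
  fixes A :: "complex^'n^'n"
  assumes "pos_semidef A"
  obtains U d where "unitary U" "A = U ** real_diag d ** conj_transpose U" "\<And>i. 0 \<le> d i"
proof -
  have herm: "hermitian A" and pos: "cinner x (A *v x) \<in> \<real>\<^sub>\<ge>\<^sub>0" for x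
    using assms by (auto simp: pos_semidef_def cinner_def)
  from hermitian_spectral[OF herm] obtain U d
    where "unitary U" "A = U ** real_diag d ** conj_transpose U"
      and d: "\<And>i. \<exists>x. cinner x (A *v x) = complex_of_real (d i)" by blast
  moreover have "0 \<le> d i" for i
  proof -
    obtain x where "cinner x (A *v x) = complex_of_real (d i)" using d by blast
    then have "complex_of_real (d i) \<in> \<real>\<^sub>\<ge>\<^sub>0" using pos by metis
    then show ?thesis by (simp add: complex_nonneg_Reals_iff)
  qed
  ultimately show ?thesis using that by blast
qed

section \<open>Unitary invariance and Schur multipliers\<close>

text \<open>In this form unitary invariance follows from cyclicity of the trace.\<close>

lemma hs_norm_square_trace:
  "complex_of_real ((hs_norm M)\<^sup>2) = trace (conj_transpose M ** M)"
proof -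
  have "(hs_norm M)\<^sup>2 = (\<Sum>i\<in>UNIV. \<Sum>j\<in>UNIV. (cmod (M $ i $ j))\<^sup>2)"
    by (simp add: hs_norm_def sum_nonneg)
  also have "\<dots> = (\<Sum>j\<in>UNIV. \<Sum>i\<in>UNIV. (cmod (M $ i $ j))\<^sup>2)"
    by (rule sum.swap)
  also have "complex_of_real \<dots> = trace (conj_transpose M ** M)"
    by (simp add: trace_def matrix_matrix_mult_def conj_transpose_def complex_norm_square
        mult.commute del: of_real_power)
  finally show ?thesis .
qed

lemma conj_transpose_mult:
  fixes M :: "complex^'n^'m" and N :: "complex^'k^'n"
  shows "conj_transpose (M ** N) = conj_transpose N ** conj_transpose M"
  by (simp add: vec_eq_iff conj_transpose_def matrix_matrix_mult_def mult.commute)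

lemma conj_transpose_conj_transpose [simp]: "conj_transpose (conj_transpose M) = M"
  by (simp add: vec_eq_iff conj_transpose_def)

lemma hs_norm_unitary:
  fixes U V M :: "complex^'n^'n"
  assumes U: "unitary U" and V: "unitary V"
  shows "hs_norm (U ** M ** conj_transpose V) = hs_norm M"
proof -
  have "conj_transpose (U ** M ** conj_transpose V) ** (U ** M ** conj_transpose V)
      = V ** (conj_transpose M ** (conj_transpose U ** U) ** M ** conj_transpose V)"
    by (simp add: conj_transpose_mult matrix_mul_assoc)
  also have "trace \<dots> = trace (conj_transpose M ** M)"
    using U V by (subst trace_mul_sym) (simp add: unitary_def flip: matrix_mul_assoc)
  finally have "(hs_norm (U ** M ** conj_transpose V))\<^sup>2 = (hs_norm M)\<^sup>2"
    by (metis hs_norm_square_trace of_real_eq_iff)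
  moreover have "hs_norm N \<ge> 0" for N :: "complex^'n^'n"
    by (simp add: hs_norm_def sum_nonneg)
  ultimately show ?thesis by (simp add: power2_eq_iff_nonneg)
qed

lemma matrix_mult_diff_left: "(M - N) ** P = M ** P - N ** P"
  for M N :: "complex^'n^'m" and P :: "complex^'k^'n"
  by (simp add: vec_eq_iff matrix_matrix_mult_def left_diff_distrib sum_subtractf)

lemma matrix_mult_diff_right: "P ** (M - N) = P ** M - P ** N"
  for M N :: "complex^'n^'m" and P :: "complex^'m^'k"
  by (simp add: vec_eq_iff matrix_matrix_mult_def right_diff_distrib sum_subtractf)

lemma matrix_mult_add_left: "(M + N) ** P = M ** P + N ** P"
  for M N :: "complex^'n^'m" and P :: "complex^'k^'n"
  by (simp add: vec_eq_iff matrix_matrix_mult_def distrib_right sum.distrib)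

lemma real_diag_sandwich:
  fixes Y :: "complex^'n^'n"
  shows "real_diag a ** Y ** real_diag b = (\<chi> i j. complex_of_real (a i * b j) * Y $ i $ j)"
proof -
  have "real_diag a ** Y = (\<chi> i j. complex_of_real (a i) * Y $ i $ j)"
    by (simp add: vec_eq_iff real_diag_def matrix_matrix_mult_def
        if_distrib[of "\<lambda>x. x * _"] cong: if_cong)
  moreover have "M ** real_diag b = (\<chi> i j. M $ i $ j * complex_of_real (b j))" for M :: "complex^'n^'n"
    by (simp add: vec_eq_iff real_diag_def matrix_matrix_mult_def
        if_distrib[of "\<lambda>x. _ * x"] cong: if_cong)
  ultimately show ?thesis by (simp add: mult.commute mult.left_commute)
qed

lemma real_diag_one: "real_diag (\<lambda>_. 1) = mat 1"
  by (simp add: real_diag_def mat_def vec_eq_iff)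

text \<open>The Schur multiplier with symbol \<open>c\<close> relative to the orthonormal bases formed by
  the columns of \<open>U\<close> and \<open>V\<close>.\<close>

definition double_op :: "complex^'n^'n \<Rightarrow> complex^'n^'n \<Rightarrow> complex^'n^'n \<Rightarrow> ('n \<Rightarrow> 'n \<Rightarrow> real)
    \<Rightarrow> complex^'n^'n" where
  "double_op U V X c = U ** (\<chi> i j. complex_of_real (c i j) *
     (conj_transpose U ** X ** V) $ i $ j) ** conj_transpose V"

text \<open>This and the next two lemmas give linearity in the symbol, so matrix combinations reduce
  to scalar ones.\<close>

lemma double_op_diff:
  "double_op U V X c - double_op U V X c' = double_op U V X (\<lambda>i j. c i j - c' i j)"
proof -
  let ?Y = "conj_transpose U ** X ** V"
  have "(\<chi> i j. complex_of_real (c i j - c' i j) * ?Y $ i $ j) = (\<chi> i j. complex_of_real (c i j) * ?Y $ i $ j)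
      - (\<chi> i j. complex_of_real (c' i j) * ?Y $ i $ j)"
    by (simp add: vec_eq_iff algebra_simps scaleR_conv_of_real[where 'a = complex])
  then show ?thesis
    unfolding double_op_def by (simp only: matrix_mult_diff_left matrix_mult_diff_right)
qed

lemma double_op_add:
  "double_op U V X c + double_op U V X c' = double_op U V X (\<lambda>i j. c i j + c' i j)"
proof -
  let ?Y = "conj_transpose U ** X ** V"
  have "(\<chi> i j. complex_of_real (c i j + c' i j) * ?Y $ i $ j) = (\<chi> i j. complex_of_real (c i j) * ?Y $ i $ j)
      + (\<chi> i j. complex_of_real (c' i j) * ?Y $ i $ j)"
    by (simp add: vec_eq_iff algebra_simps scaleR_conv_of_real[where 'a = complex])
  then show ?thesis
    unfolding double_op_def by (simp only: matrix_mult_add_left matrix_add_ldistrib)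
qed

lemma double_op_scaleR:
  "s *\<^sub>R double_op U V X c = double_op U V X (\<lambda>i j. s * c i j)"
proof -
  let ?Y = "conj_transpose U ** X ** V"
  have "(\<chi> i j. complex_of_real (s * c i j) * ?Y $ i $ j) = s *\<^sub>R (\<chi> i j. complex_of_real (c i j) * ?Y $ i $ j)"
    by (simp add: vec_eq_iff algebra_simps scaleR_conv_of_real[where 'a = complex])
  then show ?thesis
    unfolding double_op_def by (simp only: scalar_matrix_assoc matrix_scalar_ac)
qed

lemma hs_norm_double_op:
  assumes "unitary U" "unitary V"
  shows "(hs_norm (double_op U V X c))\<^sup>2
    = (\<Sum>i\<in>UNIV. \<Sum>j\<in>UNIV. (c i j)\<^sup>2 * (cmod ((conj_transpose U ** X ** V) $ i $ j))\<^sup>2)"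
  unfolding double_op_def hs_norm_unitary[OF assms]
  by (simp add: hs_norm_def sum_nonneg norm_mult power_mult_distrib)

lemma double_op_eq:
  "(U ** real_diag a ** conj_transpose U) ** X ** (V ** real_diag b ** conj_transpose V)
    = double_op U V X (\<lambda>i j. a i * b j)"
  unfolding double_op_def real_diag_sandwich[symmetric] by (simp add: matrix_mul_assoc)

section \<open>Summing the scalar inequalities over pairs of eigenvalues\<close>

theorem theorem4p1:
  fixes A B X :: "complex^'n^'n" and \<nu> :: real
  assumes "pos_semidef A" and "pos_semidef B" and "0 < \<nu>" and "\<nu> < 1"
  shows "let T = (\<lambda>k::nat. young_r \<nu> k *
           (hs_norm (matrix_powr A (1 - young_m \<nu> k / 2 ^ k) ** X ** matrix_powr B (young_m \<nu> k / 2 ^ k)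
                     - matrix_powr A (1 - (young_m \<nu> k + 1) / 2 ^ k) ** X
                         ** matrix_powr B ((young_m \<nu> k + 1) / 2 ^ k)))\<^sup>2)
         in T summable_on {1..} \<and>
            (hs_norm (matrix_powr A (1 - \<nu>) ** X ** matrix_powr B \<nu>))\<^sup>2
              + (young_r \<nu> 0)\<^sup>2 * (hs_norm (A ** X - X ** B))\<^sup>2
              + (\<Sum>\<^sub>\<infinity>k\<in>{1..}. T k)
            \<le> (hs_norm ((1 - \<nu>) *\<^sub>R (A ** X) + \<nu> *\<^sub>R (X ** B)))\<^sup>2"
proof -
  obtain U a where U: "unitary U" and A: "A = U ** real_diag a ** conj_transpose U"
    and a: "\<And>i. 0 \<le> a i" using pos_semidef_spectral[OF assms(1)] by blast
  obtain V b where V: "unitary V" and B: "B = V ** real_diag b ** conj_transpose V"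
    and b: "\<And>i. 0 \<le> b i" using pos_semidef_spectral[OF assms(2)] by blast
  define K where "K = double_op U V X"
  define w where "w i j = (cmod ((conj_transpose U ** X ** V) $ i $ j))\<^sup>2" for i j
  have hs: "(hs_norm (K c))\<^sup>2 = (\<Sum>i\<in>UNIV. \<Sum>j\<in>UNIV. (c i j)\<^sup>2 * w i j)" for c
    by (simp add: K_def w_def hs_norm_double_op[OF U V])
  have powr: "matrix_powr A (1 - t) ** X ** matrix_powr B t = K (\<lambda>i j. geo_mean (a i) (b j) t)" for t
    unfolding matrix_powr_def matrix_fun_eq[OF U A] matrix_fun_eq[OF V B] double_op_eq
      K_def geo_mean_def real_pow_def ..
  \<comment> \<open>The missing right factor is the identity, diagonalised by \<open>V\<close> with
    all eigenvalues 1; \<open>XB\<close> uses \<open>U\<close> likewise.\<close>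
  have AX: "A ** X = K (\<lambda>i j. a i)"
    using double_op_eq[of U a X V "\<lambda>_. 1"] V
    by (simp add: K_def A real_diag_one unitary_def)
  have XB: "X ** B = K (\<lambda>i j. b j)"
    using double_op_eq[of U "\<lambda>_. 1" X V b] U
    by (simp add: K_def B real_diag_one unitary_def)
  define T where "T = (\<lambda>k::nat. young_r \<nu> k *
           (hs_norm (matrix_powr A (1 - young_m \<nu> k / 2 ^ k) ** X ** matrix_powr B (young_m \<nu> k / 2 ^ k)
                     - matrix_powr A (1 - (young_m \<nu> k + 1) / 2 ^ k) ** X
                         ** matrix_powr B ((young_m \<nu> k + 1) / 2 ^ k)))\<^sup>2)"
  define D where "D k i j = young_r \<nu> k * (geo_mean (a i) (b j) (young_m \<nu> k / 2 ^ k)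
      - geo_mean (a i) (b j) ((young_m \<nu> k + 1) / 2 ^ k))\<^sup>2" for k i j
  have T: "T k = (\<Sum>i\<in>UNIV. \<Sum>j\<in>UNIV. D k i j * w i j)" for k
    by (simp only: T_def D_def powr K_def[symmetric] double_op_diff[of U V X, folded K_def] hs
        sum_distrib_left mult.assoc)
  have T_nonneg: "0 \<le> T k" for k
    by (simp add: T_def young_r_nonneg assms del: young_r.simps)
  define P where "P = (hs_norm (matrix_powr A (1 - \<nu>) ** X ** matrix_powr B \<nu>))\<^sup>2
              + (young_r \<nu> 0)\<^sup>2 * (hs_norm (A ** X - X ** B))\<^sup>2"
  define R where "R = (hs_norm ((1 - \<nu>) *\<^sub>R (A ** X) + \<nu> *\<^sub>R (X ** B)))\<^sup>2"
  have P: "P = (\<Sum>i\<in>UNIV. \<Sum>j\<in>UNIV.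
      ((geo_mean (a i) (b j) \<nu>)\<^sup>2 + (young_r \<nu> 0)\<^sup>2 * (a i - b j)\<^sup>2) * w i j)"
    unfolding P_def powr AX XB unfolding K_def double_op_diff unfolding K_def[symmetric] hs
    by (simp add: distrib_right sum.distrib sum_distrib_left mult.assoc del: young_r.simps)
  have R: "R = (\<Sum>i\<in>UNIV. \<Sum>j\<in>UNIV. ((1 - \<nu>) * a i + \<nu> * b j)\<^sup>2 * w i j)"
    unfolding R_def AX XB unfolding K_def double_op_scaleR double_op_add
    unfolding K_def[symmetric] hs ..
  have partial: "P + (\<Sum>k=1..n. T k) \<le> R" for n
  proof -
    \<comment> \<open>Moving the sum over \<open>k\<close> inside lets the scalar inequality apply
      to each pair of eigenvalues separately.\<close>
    have "(\<Sum>k=1..n. T k) = (\<Sum>i\<in>UNIV. \<Sum>j\<in>UNIV. (\<Sum>k=1..n. D k i j) * w i j)"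
      unfolding T sum_distrib_right
      by (subst sum.swap, intro sum.cong refl, rule sum.swap)
    then have "P + (\<Sum>k=1..n. T k) = (\<Sum>i\<in>UNIV. \<Sum>j\<in>UNIV.
        ((geo_mean (a i) (b j) \<nu>)\<^sup>2 + (young_r \<nu> 0)\<^sup>2 * (a i - b j)\<^sup>2 + (\<Sum>k=1..n. D k i j)) * w i j)"
      unfolding P by (simp add: distrib_right sum.distrib del: young_r.simps)
    also have "\<dots> \<le> R"
      unfolding R D_def using refined_young_scalar[OF a b assms(3,4)]
      by (intro sum_mono mult_right_mono) (auto simp: w_def simp del: young_r.simps)
    finally show ?thesis .
  qed
  \<comment> \<open>Summability of a nonnegative family needs a bound over all finite index sets;
    each lies in an initial segment, where \<open>partial\<close> applies.\<close>
  have bound: "sum T F \<le> R - P" if F: "finite F" "F \<subseteq> {1..}" for F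
  proof -
    have "F \<subseteq> {1..Max F}" using F by auto
    then have "sum T F \<le> sum T {1..Max F}" by (intro sum_mono2) (auto simp: T_nonneg)
    then show ?thesis using partial[of "Max F"] by simp
  qed
  have "T summable_on {1..}"
    by (rule nonneg_bdd_above_summable_on) (auto simp: T_nonneg intro!: bdd_aboveI2[of _ _ "R - P"] bound)
  moreover have "infsum T {1..} \<le> R - P"
    using calculation bound by (rule infsum_le_finite_sums)
  ultimately show ?thesis
    unfolding Let_def T_def[symmetric] P_def[symmetric] R_def[symmetric] by simp
qed

end
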